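(* The following are equivalent for any ordered magma $M$. (1) $M$ is a precoherent prequantale. (2) $M$ is isomorphic to the ideal completion $\mathsf{Idl}(N)$ under $\downarrow$-multiplication of some prequantic semilattice $N$. (3) $\mathsf{K}(M)$ is a sub prequantic semilattice of $M$ and $M$ is isomorphic to the ordered magma $\mathsf{Idl}(\mathsf{K}(M))$ under $\downarrow$-multiplication. (4) $M$ is isomorphic to $(2^N)^\star$ for some prequantic semilattice $N$ and some finitary nucleus $\star$ on $2^N$.
   Context: An ordered magma is a set with a binary operation (written multiplicatively) and a partial order such that $x\le x'$, $y \le y'$ imply $xy \le x'y'$; isomorphisms are order isomorphisms that are magma homomorphisms. A prequantale is an ordered magma $Q$ such that $\bigvee X$ exists and $a(\bigvee X) = \bigvee(aX)$, $(\bigvee X)a = \bigvee(Xa)$ for every $a \in Q$ and every $X\subseteq Q$. A prequantic semilattice is an ordered magma that is a join semilattice with $a(x\vee y) = ax \vee ay$ and $(x\vee y)a = xa\vee ya$ for all $a,x,y$, and that has a least element $0$ satisfying $0x=0=x0$ for all $x$. "$\mathsf{K}(M)$ is a sub prequantic semilattice of $M$" means that $\mathsf{K}(M)$ is closed under multiplication in $M$, that every finite subset of $\mathsf{K}(M)$ (including $\emptyset$) has a supremum in $M$ lying in $\mathsf{K}(M)$, and that $\mathsf{K}(M)$ with the induced structure is a prequantic semilattice. A directed subset of a poset is a nonempty subset $\Delta$ in which every finite subset has an upper bound in $\Delta$. An element $x$ of a poset $S$ is compact if, whenever $x \le \bigvee\Delta$ for a directed $\Delta\subseteq S$ for which $\bigvee\Delta$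 exists, one has $x \le y$ for some $y \in \Delta$; $\mathsf{K}(S)$ is the set of compact elements of $S$. An ordered magma $M$ is precoherent if every element is the supremum of a set of compact elements and $\mathsf{K}(M)$ is closed under multiplication. An ideal of a poset $S$ is a directed downward closed subset; $\mathsf{Idl}(S)$ is the set of ideals ordered by inclusion. For a join semilattice $S$ and nonempty $X\subseteq S$, $\downarrow\! X = \{y\in S: y\le \bigvee T \text{ for some finite nonempty } T\subseteq X\}$; $\downarrow$-multiplication on $\mathsf{Idl}(N)$ is $(I,J)\mapsto\ \downarrow\!(IJ)$, where $IJ=\{xy: x\in I,y\in J\}$. $2^N$ is the power set of $N$, ordered by inclusion, with multiplication $(X,Y)\mapsto XY$. A closure operation is an expansive, order-preserving, idempotent self-map; a nucleus on an ordered magma $P$ is a closure operation $\star$ with $x^\star y^\star\le (xy)^\star$; its image $P^\star$ is an ordered magma under the induced order and $(x,y)\mapsto (xy)^\star$. A closure operation $\star$ is finitary if $(\bigvee\Delta)^\star=\bigvee(\Delta^\star)$ for all directed $\Delta$ for which $\bigvee\Delta$ exists. *)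

theory Defs
  imports "HOL-Algebra.Lattice"
begin

text \<open>
  A set with a binary operation and a relation \<open>\<sqsubseteq>\<close>, relativised to a carrier. The field \<^const>\<open>eq\<close>
  inherited from \<^typ>\<open>'a gorder\<close> is forced to be HOL equality by the locale \<^locale>\<open>partial_order\<close>.
\<close>

record 'a omagma = "'a gorder" +
  omult :: "'a \<Rightarrow> 'a \<Rightarrow> 'a" (infixl \<open>\<cdot>\<index>\<close> 70)

locale ordered_magma = partial_order M for M (structure) +
  assumes omult_closed: "\<lbrakk>x \<in> carrier M; y \<in> carrier M\<rbrakk> \<Longrightarrow> x \<cdot> y \<in> carrier M"
    and omult_mono:
      "\<lbrakk>x \<in> carrier M; x' \<in> carrier M; y \<in> carrier M; y' \<in> carrier M; x \<sqsubseteq> x'; y \<sqsubseteq> y'\<rbrakk>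
        \<Longrightarrow> x \<cdot> y \<sqsubseteq> x' \<cdot> y'"

definition omagma_isomorphism ::
  "('a, 'm) omagma_scheme \<Rightarrow> ('b, 'n) omagma_scheme \<Rightarrow> ('a \<Rightarrow> 'b) \<Rightarrow> bool"
  where "omagma_isomorphism M N h \<longleftrightarrow>
    bij_betw h (carrier M) (carrier N) \<and> order_emb M N h \<and>
    (\<forall>x\<in>carrier M. \<forall>y\<in>carrier M. h (x \<cdot>\<^bsub>M\<^esub> y) = h x \<cdot>\<^bsub>N\<^esub> h y)"

definition omagma_isomorphic ::
  "('a, 'm) omagma_scheme \<Rightarrow> ('b, 'n) omagma_scheme \<Rightarrow> bool"
  where "omagma_isomorphic M N \<longleftrightarrow> (\<exists>h. omagma_isomorphism M N h)"

locale prequantale = ordered_magma Q for Q (structure) +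
  assumes sup_exists: "X \<subseteq> carrier Q \<Longrightarrow> \<exists>s. is_lub Q s X"
    and omult_sup_left:
      "\<lbrakk>a \<in> carrier Q; X \<subseteq> carrier Q\<rbrakk> \<Longrightarrow> a \<cdot> (\<Squnion>X) = \<Squnion>((\<lambda>x. a \<cdot> x) ` X)"
    and omult_sup_right:
      "\<lbrakk>a \<in> carrier Q; X \<subseteq> carrier Q\<rbrakk> \<Longrightarrow> (\<Squnion>X) \<cdot> a = \<Squnion>((\<lambda>x. x \<cdot> a) ` X)"

locale prequantic_semilattice =
  ordered_magma Q + upper_semilattice Q + weak_partial_order_bottom Q for Q (structure) +
  assumes omult_join_left:
      "\<lbrakk>a \<in> carrier Q; x \<in> carrier Q; y \<in> carrier Q\<rbrakk> \<Longrightarrow> a \<cdot> (x \<squnion> y) = (a \<cdot> x) \<squnion> (a \<cdot> y)"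
    and omult_join_right:
      "\<lbrakk>a \<in> carrier Q; x \<in> carrier Q; y \<in> carrier Q\<rbrakk> \<Longrightarrow> (x \<squnion> y) \<cdot> a = (x \<cdot> a) \<squnion> (y \<cdot> a)"
    and bottom_omult: "x \<in> carrier Q \<Longrightarrow> \<bottom> \<cdot> x = \<bottom>"
    and omult_bottom: "x \<in> carrier Q \<Longrightarrow> x \<cdot> \<bottom> = \<bottom>"

definition sub_prequantic_semilattice :: "'a set \<Rightarrow> ('a, 'm) omagma_scheme \<Rightarrow> bool"
  where "sub_prequantic_semilattice A M \<longleftrightarrow>
    A \<subseteq> carrier M \<and>
    (\<forall>x\<in>A. \<forall>y\<in>A. x \<cdot>\<^bsub>M\<^esub> y \<in> A) \<and>
    (\<forall>F. finite F \<and> F \<subseteq> A \<longrightarrow> (\<exists>s\<in>A. is_lub M s F)) \<and>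
    prequantic_semilattice (M\<lparr>carrier := A\<rparr>)"

definition directed_in :: "('a, 'm) gorder_scheme \<Rightarrow> 'a set \<Rightarrow> bool"
  where "directed_in S D \<longleftrightarrow>
    D \<subseteq> carrier S \<and> D \<noteq> {} \<and>
    (\<forall>F. finite F \<and> F \<subseteq> D \<longrightarrow> (\<exists>u\<in>D. u \<in> Upper S F))"

definition compact_elements :: "('a, 'm) gorder_scheme \<Rightarrow> 'a set"
  where "compact_elements S =
    {x \<in> carrier S. \<forall>D s. directed_in S D \<and> is_lub S s D \<and> x \<sqsubseteq>\<^bsub>S\<^esub> s
                          \<longrightarrow> (\<exists>y\<in>D. x \<sqsubseteq>\<^bsub>S\<^esub> y)}"

locale precoherent = ordered_magma M for M (structure) +
  assumes sup_of_compacts: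
      "x \<in> carrier M \<Longrightarrow> \<exists>X. X \<subseteq> compact_elements M \<and> is_lub M x X"
    and compact_omult_closed:
      "\<lbrakk>x \<in> compact_elements M; y \<in> compact_elements M\<rbrakk> \<Longrightarrow> x \<cdot> y \<in> compact_elements M"

text \<open>
  Ideals in the sense of order theory; \<open>HOL-Algebra\<close> uses the word for ring ideals.
\<close>

definition order_ideal :: "('a, 'm) gorder_scheme \<Rightarrow> 'a set \<Rightarrow> bool"
  where "order_ideal S I \<longleftrightarrow>
    directed_in S I \<and> (\<forall>x\<in>I. \<forall>y\<in>carrier S. y \<sqsubseteq>\<^bsub>S\<^esub> x \<longrightarrow> y \<in> I)"

definition setmult :: "('a, 'm) omagma_scheme \<Rightarrow> 'a set \<Rightarrow> 'a set \<Rightarrow> 'a set"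
  where "setmult M X Y = {x \<cdot>\<^bsub>M\<^esub> y |x y. x \<in> X \<and> y \<in> Y}"

text \<open>Meant for nonempty subsets of an \<^locale>\<open>upper_semilattice\<close>, where the suprema exist.\<close>

definition ideal_down :: "('a, 'm) gorder_scheme \<Rightarrow> 'a set \<Rightarrow> 'a set"
  where "ideal_down S X =
    {y \<in> carrier S. \<exists>T. finite T \<and> T \<noteq> {} \<and> T \<subseteq> X \<and> y \<sqsubseteq>\<^bsub>S\<^esub> \<Squnion>\<^bsub>S\<^esub>T}"

definition Idl :: "('a, 'm) omagma_scheme \<Rightarrow> 'a set omagma"
  where "Idl N =
    \<lparr>carrier = {I. order_ideal N I}, eq = (=), le = (\<subseteq>),
     omult = (\<lambda>I J. ideal_down N (setmult N I J))\<rparr>"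

definition powerset_magma :: "('a, 'm) omagma_scheme \<Rightarrow> 'a set omagma"
  where "powerset_magma N =
    \<lparr>carrier = Pow (carrier N), eq = (=), le = (\<subseteq>), omult = setmult N\<rparr>"

definition closure_operation :: "('a, 'm) gorder_scheme \<Rightarrow> ('a \<Rightarrow> 'a) \<Rightarrow> bool"
  where "closure_operation P f \<longleftrightarrow>
    f \<in> carrier P \<rightarrow> carrier P \<and> (\<forall>x\<in>carrier P. x \<sqsubseteq>\<^bsub>P\<^esub> f x) \<and>
    isotone P P f \<and> idempotent P f"

definition nucleus :: "('a, 'm) omagma_scheme \<Rightarrow> ('a \<Rightarrow> 'a) \<Rightarrow> bool"
  where "nucleus P f \<longleftrightarrow>
    closure_operation P f \<and>
    (\<forall>x\<in>carrier P. \<forall>y\<in>carrier P. f x \<cdot>\<^bsub>P\<^esub> f y \<sqsubseteq>\<^bsub>P\<^esub> f (x \<cdot>\<^bsub>P\<^esub> y))"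

text \<open>
  The supremum of \<open>f ` D\<close> is taken in \<open>P\<close>, and its existence is part of the condition.
\<close>

definition finitary :: "('a, 'm) gorder_scheme \<Rightarrow> ('a \<Rightarrow> 'a) \<Rightarrow> bool"
  where "finitary P f \<longleftrightarrow>
    (\<forall>D s. directed_in P D \<and> is_lub P s D \<longrightarrow> is_lub P (f s) (f ` D))"

definition nucleus_image :: "('a, 'm) omagma_scheme \<Rightarrow> ('a \<Rightarrow> 'a) \<Rightarrow> ('a, 'm) omagma_scheme"
  where "nucleus_image P f =
    P\<lparr>carrier := f ` carrier P, omult := (\<lambda>x y. f (x \<cdot>\<^bsub>P\<^esub> y))\<rparr>"

end

theory Submission
  imports Defs
begin

text \<open>
  For (2) \<open>\<Longrightarrow>\<close> (4), sending a subset of \<open>N\<close> to the ideal it generates is a finitary nucleus on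
  \<open>2\<^sup>N\<close> whose image is \<open>Idl(N)\<close>. For (4) \<open>\<Longrightarrow>\<close> (1), the image of a finitary nucleus \<open>f\<close> has the
  suprema \<open>f(\<Union>A)\<close> and exactly the compact elements \<open>f(F)\<close> with \<open>F\<close> finite; these are closed under
  multiplication because \<open>f(f(F)f(G)) = f(FG)\<close>. For (1) \<open>\<Longrightarrow>\<close> (3), map \<open>x\<close> to the ideal of compact
  elements below it; it is inverted by taking suprema since \<open>k \<le> \<Squnion>I\<close> with \<open>k\<close> compact forces
  \<open>k \<in> I\<close>, and it is multiplicative because both sides are ideals with supremum \<open>xy\<close>.
\<close>

section \<open>Least upper bounds, directed sets and products of subsets\<close>

lemma is_lub_iff:
  fixes L (structure)
  assumes "X \<subseteq> carrier L"
  shows "is_lub L s X \<longleftrightarrow>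
    s \<in> carrier L \<and> (\<forall>x\<in>X. x \<sqsubseteq> s) \<and> (\<forall>u\<in>carrier L. (\<forall>x\<in>X. x \<sqsubseteq> u) \<longrightarrow> s \<sqsubseteq> u)"
  using assms unfolding least_def Upper_def by blast

text \<open>An upper bound of \<open>Y\<close> also bounds \<open>X\<close>, so \<open>s\<close>
  lies below it. A supremum thus passes from a generating family to a larger one that it still
  bounds.\<close>

lemma (in weak_partial_order) is_lub_between:
  assumes "is_lub L s X" "X \<subseteq> Y" "Y \<subseteq> carrier L" "\<And>y. y \<in> Y \<Longrightarrow> y \<sqsubseteq> s"
  shows "is_lub L s Y"
proof -
  have "X \<subseteq> carrier L" using assms by simp
  then show ?thesis using assms by (simp add: is_lub_iff subset_iff)
qed

text \<open>\<open>\<Squnion>X\<close> is a Hilbert choice among least upper bounds; where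
  \<open>eq\<close> is equality there is at most one to choose.\<close>

lemma (in partial_order) sup_equality: "is_lub L s X \<Longrightarrow> \<Squnion>X = s"
  unfolding sup_def by (blast intro: someI least_unique)

text \<open>Bounds of finite subsets are built by adding one element at a time; nonemptiness
  supplies the bound for the empty subset.\<close>

lemma (in weak_partial_order) directed_in_iff:
  "directed_in L D \<longleftrightarrow>
    D \<subseteq> carrier L \<and> D \<noteq> {} \<and> (\<forall>x\<in>D. \<forall>y\<in>D. \<exists>z\<in>D. x \<sqsubseteq> z \<and> y \<sqsubseteq> z)"
proof
  assume D: "directed_in L D"
  then have sub: "D \<subseteq> carrier L" by (simp add: directed_in_def)
  have "\<exists>z\<in>D. x \<sqsubseteq> z \<and> y \<sqsubseteq> z" if "x \<in> D" "y \<in> D" for x y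
  proof -
    from that D obtain z where "z \<in> D" "z \<in> Upper L {x, y}"
      unfolding directed_in_def by (metis empty_subsetI finite.emptyI finite.insertI insert_subset)
    moreover from this have "x \<sqsubseteq> z" "y \<sqsubseteq> z" using that sub by (simp_all add: Upper_def subsetD)
    ultimately show ?thesis by blast
  qed
  then show "D \<subseteq> carrier L \<and> D \<noteq> {} \<and> (\<forall>x\<in>D. \<forall>y\<in>D. \<exists>z\<in>D. x \<sqsubseteq> z \<and> y \<sqsubseteq> z)"
    using D by (simp add: directed_in_def)
next
  assume D: "D \<subseteq> carrier L \<and> D \<noteq> {} \<and> (\<forall>x\<in>D. \<forall>y\<in>D. \<exists>z\<in>D. x \<sqsubseteq> z \<and> y \<sqsubseteq> z)"
  have "\<exists>u\<in>D. u \<in> Upper L F" if "finite F" "F \<subseteq> D" for F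
    using that
  proof (induction F)
    case empty
    then show ?case using D by auto
  next
    case (insert x F)
    then obtain u where u: "u \<in> D" "u \<in> Upper L F" by auto
    with insert.prems D obtain z where z: "z \<in> D" "x \<sqsubseteq> z" "u \<sqsubseteq> z" by blast
    have "y \<sqsubseteq> z" if "y \<in> F" for y
    proof -
      have "y \<in> carrier L" "u \<in> carrier L" "z \<in> carrier L"
        using that u z insert.prems D by auto
      moreover from this have "y \<sqsubseteq> u" using that u by (simp add: Upper_def)
      ultimately show ?thesis using z le_trans by metis
    qed
    then have "z \<in> Upper L (insert x F)" using z D by (auto simp: Upper_def)
    with z show ?case by blast
  qed
  with D show "directed_in L D" by (simp add: directed_in_def)
qed

lemma compact_elementsD:
  assumes "x \<in> compact_elements S" "directed_in S D" "is_lub S s D" "x \<sqsubseteq>\<^bsub>S\<^esub> s"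
  obtains y where "y \<in> D" "x \<sqsubseteq>\<^bsub>S\<^esub> y"
  using assms unfolding compact_elements_def by blast

lemma compact_elements_subset: "compact_elements S \<subseteq> carrier S"
  by (auto simp: compact_elements_def)

lemma setmult_iff: "z \<in> setmult M X Y \<longleftrightarrow> (\<exists>x\<in>X. \<exists>y\<in>Y. z = x \<cdot>\<^bsub>M\<^esub> y)"
  by (auto simp: setmult_def)

lemma setmult_mono: "X \<subseteq> X' \<Longrightarrow> Y \<subseteq> Y' \<Longrightarrow> setmult M X Y \<subseteq> setmult M X' Y'"
  by (auto simp: setmult_def)

lemma setmult_Union_left: "setmult M (\<Union>A) Y = (\<Union>X\<in>A. setmult M X Y)"
  and setmult_Union_right: "setmult M X (\<Union>A) = (\<Union>Y\<in>A. setmult M X Y)"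
  by (auto simp: setmult_def)

lemma finite_setmult: "finite X \<Longrightarrow> finite Y \<Longrightarrow> finite (setmult M X Y)"
  unfolding setmult_def by (rule finite_image_set2) auto

lemma (in ordered_magma) setmult_closed:
  "X \<subseteq> carrier M \<Longrightarrow> Y \<subseteq> carrier M \<Longrightarrow> setmult M X Y \<subseteq> carrier M"
  by (auto simp: setmult_def intro!: omult_closed)

text \<open>The locale axioms speak of the choice term \<open>\<Squnion>X\<close>. Phrased through
  the relation \<open>is_lub\<close>, they can be transported along an isomorphism and checked
  against a concrete supremum.\<close>

lemma (in ordered_magma) prequantaleI:
  assumes "\<And>X. X \<subseteq> carrier M \<Longrightarrow> \<exists>s. is_lub M s X"
    and "\<And>a s X. a \<in> carrier M \<Longrightarrow> X \<subseteq> carrier M \<Longrightarrow> is_lub M s X \<Longrightarrow> is_lub M (a \<cdot> s) ((\<lambda>x. a \<cdot> x) ` X)"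
    and "\<And>a s X. a \<in> carrier M \<Longrightarrow> X \<subseteq> carrier M \<Longrightarrow> is_lub M s X \<Longrightarrow> is_lub M (s \<cdot> a) ((\<lambda>x. x \<cdot> a) ` X)"
  shows "prequantale M"
proof unfold_locales
  fix a X assume aX: "a \<in> carrier M" "X \<subseteq> carrier M"
  then obtain s where s: "is_lub M s X" using assms(1) by blast
  show "a \<cdot> (\<Squnion>X) = \<Squnion>((\<lambda>x. a \<cdot> x) ` X)"
    unfolding sup_equality[OF s] sup_equality[OF assms(2)[OF aX s]] ..
  show "(\<Squnion>X) \<cdot> a = \<Squnion>((\<lambda>x. x \<cdot> a) ` X)"
    unfolding sup_equality[OF s] sup_equality[OF assms(3)[OF aX s]] ..
qed (rule assms(1))

context prequantale
begin

lemma is_lub_sup: "X \<subseteq> carrier Q \<Longrightarrow> is_lub Q (\<Squnion>X) X"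
  by (auto dest: sup_exists simp: sup_equality)

lemma is_lub_omult_left:
  assumes a: "a \<in> carrier Q" and X: "X \<subseteq> carrier Q" "is_lub Q s X"
  shows "is_lub Q (a \<cdot> s) ((\<lambda>x. a \<cdot> x) ` X)"
proof -
  have "(\<lambda>x. a \<cdot> x) ` X \<subseteq> carrier Q"
    using a X(1) by (auto intro!: omult_closed)
  from is_lub_sup[OF this] show ?thesis
    unfolding omult_sup_left[OF a X(1), symmetric] sup_equality[OF X(2)] .
qed

lemma is_lub_omult_right:
  assumes a: "a \<in> carrier Q" and X: "X \<subseteq> carrier Q" "is_lub Q s X"
  shows "is_lub Q (s \<cdot> a) ((\<lambda>x. x \<cdot> a) ` X)"
proof -
  have "(\<lambda>x. x \<cdot> a) ` X \<subseteq> carrier Q"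
    using a X(1) by (auto intro!: omult_closed)
  from is_lub_sup[OF this] show ?thesis
    unfolding omult_sup_right[OF a X(1), symmetric] sup_equality[OF X(2)] .
qed

end

subsection \<open>Transfer along isomorphisms\<close>

lemma omagma_isomorphism_inv:
  assumes "omagma_isomorphism M N h" "ordered_magma M"
  shows "omagma_isomorphism N M (inv_into (carrier M) h)"
proof -
  interpret ordered_magma M by fact
  let ?g = "inv_into (carrier M) h"
  have bij: "bij_betw h (carrier M) (carrier N)" and emb: "order_emb M N h"
    and hom: "\<And>x y. x \<in> carrier M \<Longrightarrow> y \<in> carrier M \<Longrightarrow> h (x \<cdot>\<^bsub>M\<^esub> y) = h x \<cdot>\<^bsub>N\<^esub> h y"
    using assms by (auto simp: omagma_isomorphism_def)
  have g: "?g y \<in> carrier M" "h (?g y) = y" if "y \<in> carrier N" for y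
    using that bij by (auto simp: bij_betw_def inv_into_into f_inv_into_f)
  have gh: "?g (h x) = x" if "x \<in> carrier M" for x
    using that bij by (auto simp: bij_betw_def)
  \<comment> \<open>\<open>x\<close> and \<open>y\<close> are the images under \<open>h\<close> of
    \<open>?g x\<close> and \<open>?g y\<close>, so their product is \<open>h\<close> of a product
    in \<open>M\<close>; since \<open>carrier M\<close> is closed, \<open>?g\<close> cancels this
    \<open>h\<close>.\<close>
  have "?g (x \<cdot>\<^bsub>N\<^esub> y) = ?g x \<cdot>\<^bsub>M\<^esub> ?g y" if "x \<in> carrier N" "y \<in> carrier N" for x y
    using hom[of "?g x" "?g y"] g that gh[of "?g x \<cdot>\<^bsub>M\<^esub> ?g y"] omult_closed by simp
  moreover have "order_emb N M ?g"
    using emb g by (auto simp: order_emb_def) (metis g)+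
  ultimately show ?thesis
    using bij_betw_inv_into[OF bij] by (auto simp: omagma_isomorphism_def)
qed

lemma omagma_isomorphism_trans:
  assumes "omagma_isomorphism M N h" "omagma_isomorphism N P g"
  shows "omagma_isomorphism M P (g \<circ> h)"
proof -
  have "h x \<in> carrier N" if "x \<in> carrier M" for x
    using assms(1) that by (auto simp: omagma_isomorphism_def bij_betw_def)
  then show ?thesis
    using assms by (auto simp: omagma_isomorphism_def order_emb_def intro: bij_betw_trans)
qed

text \<open>\<open>h\<close> maps onto \<open>carrier N\<close> and both preserves and reflects the
  order, so upper bounds correspond. The equivalence serves to push suprema forward and to pull them
  back.\<close>

lemma isomorphism_is_lub:
  assumes "omagma_isomorphism M N h" "X \<subseteq> carrier M" "s \<in> carrier M"
  shows "is_lub N (h s) (h ` X) \<longleftrightarrow> is_lub M s X"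
proof -
  have N: "carrier N = h ` carrier M"
    and le: "\<And>x y. x \<in> carrier M \<Longrightarrow> y \<in> carrier M \<Longrightarrow> h x \<sqsubseteq>\<^bsub>N\<^esub> h y \<longleftrightarrow> x \<sqsubseteq>\<^bsub>M\<^esub> y"
    using assms by (auto simp: omagma_isomorphism_def order_emb_def bij_betw_def)
  have "h ` X \<subseteq> carrier N" using assms N by blast
  then show ?thesis
    using assms(2,3) unfolding is_lub_iff[OF assms(2)] is_lub_iff[OF \<open>h ` X \<subseteq> carrier N\<close>]
    by (auto simp: N le subset_iff)
qed

text \<open>\<open>h\<close> carries a directed set of \<open>M\<close> and its supremum to
  \<open>N\<close>, where compactness of \<open>h x\<close> applies. The opposite direction is this
  lemma for the inverse isomorphism.\<close>

lemma isomorphism_compact: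
  assumes iso: "omagma_isomorphism M N h" and x: "x \<in> carrier M" "h x \<in> compact_elements N"
  shows "x \<in> compact_elements M"
proof -
  have emb: "weak_partial_order M" "weak_partial_order N"
    and N: "carrier N = h ` carrier M"
    and le: "\<And>x y. x \<in> carrier M \<Longrightarrow> y \<in> carrier M \<Longrightarrow> h x \<sqsubseteq>\<^bsub>N\<^esub> h y \<longleftrightarrow> x \<sqsubseteq>\<^bsub>M\<^esub> y"
    using iso by (auto simp: omagma_isomorphism_def order_emb_def bij_betw_def)
  have "\<exists>y\<in>D. x \<sqsubseteq>\<^bsub>M\<^esub> y" if D: "directed_in M D" and s: "is_lub M s D" "x \<sqsubseteq>\<^bsub>M\<^esub> s" for D s
  proof -
    have sub: "D \<subseteq> carrier M" and sM: "s \<in> carrier M"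
      using D s by (auto simp: directed_in_def)
    have dir: "\<exists>c\<in>D. a \<sqsubseteq>\<^bsub>M\<^esub> c \<and> b \<sqsubseteq>\<^bsub>M\<^esub> c" if "a \<in> D" "b \<in> D" for a b
      using D that unfolding weak_partial_order.directed_in_iff[OF emb(1)] by blast
    have "\<exists>c\<in>D. h a \<sqsubseteq>\<^bsub>N\<^esub> h c \<and> h b \<sqsubseteq>\<^bsub>N\<^esub> h c" if ab: "a \<in> D" "b \<in> D" for a b
    proof -
      obtain c where "c \<in> D" "a \<sqsubseteq>\<^bsub>M\<^esub> c" "b \<sqsubseteq>\<^bsub>M\<^esub> c" using dir ab by blast
      then show ?thesis using ab sub le by (intro bexI[of _ c]) (auto simp: subset_iff)
    qed
    then have "directed_in N (h ` D)"
      using D image_mono[OF sub, of h] unfolding weak_partial_order.directed_in_iff[OF emb(2)] N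
      by (simp add: directed_in_def)
    moreover have "is_lub N (h s) (h ` D)" using isomorphism_is_lub[OF iso sub sM] s by simp
    moreover have "h x \<sqsubseteq>\<^bsub>N\<^esub> h s" using le x sM s by simp
    ultimately obtain y where "y \<in> h ` D" "h x \<sqsubseteq>\<^bsub>N\<^esub> y"
      using x(2) by (blast elim: compact_elementsD)
    then show ?thesis using le x sub by blast
  qed
  with x show ?thesis by (auto simp: compact_elements_def)
qed

text \<open>Suprema and sets of compact elements are found in \<open>N\<close> and pulled back by
  \<open>g\<close>; the distributive laws are tested after applying \<open>h\<close>, which turns
  products into products.\<close>

lemma isomorphism_precoherent_prequantale:
  assumes iso: "omagma_isomorphism M N h" and M: "ordered_magma M"
    and N: "prequantale N" "precoherent N"
  shows "prequantale M \<and> precoherent M"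
proof -
  interpret M: ordered_magma M by fact
  interpret N: prequantale N by fact
  interpret N: precoherent N by fact
  define g where "g = inv_into (carrier M) h"
  have bij: "bij_betw h (carrier M) (carrier N)"
    and hom: "\<And>x y. x \<in> carrier M \<Longrightarrow> y \<in> carrier M \<Longrightarrow> h (x \<cdot>\<^bsub>M\<^esub> y) = h x \<cdot>\<^bsub>N\<^esub> h y"
    using iso by (auto simp: omagma_isomorphism_def)
  have isog: "omagma_isomorphism N M g"
    unfolding g_def by (rule omagma_isomorphism_inv[OF iso M])
  have hc: "h x \<in> carrier N" if "x \<in> carrier M" for x
    using that bij by (auto simp: bij_betw_def)
  have g: "g y \<in> carrier M" "h (g y) = y" if "y \<in> carrier N" for y
    using that bij by (auto simp: g_def bij_betw_def inv_into_into f_inv_into_f)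
  have gh: "g (h x) = x" if "x \<in> carrier M" for x
    using that bij by (auto simp: g_def bij_betw_def)
  have comp: "h x \<in> compact_elements N \<longleftrightarrow> x \<in> compact_elements M" if "x \<in> carrier M" for x
    using isomorphism_compact[OF iso that] isomorphism_compact[OF isog hc[OF that]] gh[OF that]
    by auto
  have hg_image: "h ` g ` Y = Y" if "Y \<subseteq> carrier N" for Y
    unfolding image_image using that g by (simp add: subset_iff)
  have "prequantale M"
  proof (rule M.prequantaleI)
    fix X assume X: "X \<subseteq> carrier M"
    then have hX: "h ` X \<subseteq> carrier N" using hc by auto
    then obtain t where t: "is_lub N t (h ` X)" using N.sup_exists by blast
    then have "t \<in> carrier N" by simp
    then have "is_lub M (g t) X"
      using isomorphism_is_lub[OF iso X, of "g t"] g t by simp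
    then show "\<exists>s. is_lub M s X" by blast
  next
    fix a s X assume a: "a \<in> carrier M" and X: "X \<subseteq> carrier M" and s: "is_lub M s X"
    then have sM: "s \<in> carrier M" and hX: "h ` X \<subseteq> carrier N" using hc by auto
    have hs: "is_lub N (h s) (h ` X)" using isomorphism_is_lub[OF iso X sM] s by simp
    have "h ` (\<lambda>x. a \<cdot>\<^bsub>M\<^esub> x) ` X = (\<lambda>x. h a \<cdot>\<^bsub>N\<^esub> x) ` h ` X"
      unfolding image_image using X a hom by (intro image_cong) auto
    then have "is_lub N (h (a \<cdot>\<^bsub>M\<^esub> s)) (h ` (\<lambda>x. a \<cdot>\<^bsub>M\<^esub> x) ` X)"
      using N.is_lub_omult_left[OF hc[OF a] hX hs] hom a sM by simp
    moreover have "(\<lambda>x. a \<cdot>\<^bsub>M\<^esub> x) ` X \<subseteq> carrier M" using a X M.omult_closed by auto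
    ultimately show "is_lub M (a \<cdot>\<^bsub>M\<^esub> s) ((\<lambda>x. a \<cdot>\<^bsub>M\<^esub> x) ` X)"
      using isomorphism_is_lub[OF iso _ M.omult_closed[OF a sM]] by simp
    have "h ` (\<lambda>x. x \<cdot>\<^bsub>M\<^esub> a) ` X = (\<lambda>x. x \<cdot>\<^bsub>N\<^esub> h a) ` h ` X"
      unfolding image_image using X a hom by (intro image_cong) auto
    then have "is_lub N (h (s \<cdot>\<^bsub>M\<^esub> a)) (h ` (\<lambda>x. x \<cdot>\<^bsub>M\<^esub> a) ` X)"
      using N.is_lub_omult_right[OF hc[OF a] hX hs] hom a sM by simp
    moreover have "(\<lambda>x. x \<cdot>\<^bsub>M\<^esub> a) ` X \<subseteq> carrier M" using a X M.omult_closed by auto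
    ultimately show "is_lub M (s \<cdot>\<^bsub>M\<^esub> a) ((\<lambda>x. x \<cdot>\<^bsub>M\<^esub> a) ` X)"
      using isomorphism_is_lub[OF iso _ M.omult_closed[OF sM a]] by simp
  qed
  moreover have "precoherent M"
  proof unfold_locales
    fix x assume x: "x \<in> carrier M"
    obtain Y where Y: "Y \<subseteq> compact_elements N" "is_lub N (h x) Y"
      using N.sup_of_compacts[OF hc[OF x]] by blast
    have YN: "Y \<subseteq> carrier N" using Y(1) compact_elements_subset by (rule order_trans)
    then have gY: "g ` Y \<subseteq> carrier M" using g by auto
    have "is_lub M x (g ` Y)"
      using isomorphism_is_lub[OF iso gY x] Y hg_image[OF YN] by simp
    moreover have "g ` Y \<subseteq> compact_elements M"
    proof
      fix z assume "z \<in> g ` Y"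
      then obtain y where "y \<in> Y" "z = g y" by blast
      with Y YN show "z \<in> compact_elements M" using comp[of z] g[of y] by (simp add: subsetD)
    qed
    ultimately show "\<exists>X. X \<subseteq> compact_elements M \<and> is_lub M x X" by blast
  next
    fix x y assume xy: "x \<in> compact_elements M" "y \<in> compact_elements M"
    then have "x \<in> carrier M" "y \<in> carrier M" by (simp_all add: compact_elements_def)
    then show "x \<cdot>\<^bsub>M\<^esub> y \<in> compact_elements M"
      using xy comp hom N.compact_omult_closed M.omult_closed by metis
  qed
  ultimately show ?thesis ..
qed

subsection \<open>Images of finitary nuclei on power sets\<close>

lemma powerset_magma_simps [simp]:
  "carrier (powerset_magma N) = Pow (carrier N)"
  "eq (powerset_magma N) = (=)"
  "le (powerset_magma N) = (\<subseteq>)"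
  "omult (powerset_magma N) = setmult N"
  by (simp_all add: powerset_magma_def)

lemma partial_order_subset_order:
  fixes L (structure)
  assumes "eq L = (=)" "le L = (\<subseteq>)"
  shows "partial_order L"
  using assms by unfold_locales auto

lemma is_lub_powerset_iff:
  assumes "D \<subseteq> Pow (carrier N)"
  shows "is_lub (powerset_magma N) s D \<longleftrightarrow> s = \<Union>D"
proof
  interpret partial_order "powerset_magma N" by (rule partial_order_subset_order) simp_all
  have lub: "is_lub (powerset_magma N) (\<Union>D) D"
    using assms by (subst is_lub_iff) auto
  then show "is_lub (powerset_magma N) s D \<Longrightarrow> s = \<Union>D"
    by (rule least_unique[rotated])
  show "s = \<Union>D \<Longrightarrow> is_lub (powerset_magma N) s D"
    using lub by simp
qed

locale powerset_nucleus = ordered_magma N for N (structure) +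
  fixes f
  assumes nucleus: "nucleus (powerset_magma N) f"
begin

lemma f_closed: "X \<subseteq> carrier N \<Longrightarrow> f X \<subseteq> carrier N"
  and f_expansive: "X \<subseteq> carrier N \<Longrightarrow> X \<subseteq> f X"
  and f_mono: "Y \<subseteq> carrier N \<Longrightarrow> X \<subseteq> Y \<Longrightarrow> f X \<subseteq> f Y"
  and f_idem: "X \<subseteq> carrier N \<Longrightarrow> f (f X) = f X"
  and f_mult: "X \<subseteq> carrier N \<Longrightarrow> Y \<subseteq> carrier N \<Longrightarrow> setmult N (f X) (f Y) \<subseteq> f (setmult N X Y)"
  using nucleus
  by (auto simp: nucleus_def closure_operation_def isotone_def idempotent_def Pi_iff; blast)+

text \<open>\<open>f Y\<close> is a fixed point, so closing a subset of it does not leave it: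
  \<open>f X\<close> is the least closed set containing \<open>X\<close>.\<close>

lemma f_least: "X \<subseteq> carrier N \<Longrightarrow> Y \<subseteq> carrier N \<Longrightarrow> X \<subseteq> f Y \<Longrightarrow> f X \<subseteq> f Y"
  using f_mono[OF f_closed] f_idem by metis

text \<open>The nucleus inequality with idempotence gives one inclusion, expansiveness the other.
  Products in the image can hence be computed from any generating sets.\<close>

lemma f_setmult:
  assumes "X \<subseteq> carrier N" "Y \<subseteq> carrier N"
  shows "f (setmult N (f X) (f Y)) = f (setmult N X Y)"
proof
  show "f (setmult N (f X) (f Y)) \<subseteq> f (setmult N X Y)"
    using assms by (intro f_least f_mult setmult_closed f_closed)
  show "f (setmult N X Y) \<subseteq> f (setmult N (f X) (f Y))"
    using assms by (intro f_mono setmult_mono setmult_closed f_expansive f_closed)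
qed

text \<open>Each closed member already lies in \<open>f (\<Union>A)\<close> by monotonicity, so
  closing the members first adds nothing. This moves \<open>f\<close> inside a union in the
  distributive laws.\<close>

lemma f_Union:
  assumes "A \<subseteq> Pow (carrier N)"
  shows "f (\<Union>(f ` A)) = f (\<Union>A)"
proof
  have sub: "f X \<subseteq> carrier N" "X \<subseteq> f X" if "X \<in> A" for X
    using assms that by (auto intro!: f_closed f_expansive[THEN subsetD])
  show "f (\<Union>(f ` A)) \<subseteq> f (\<Union>A)"
  proof (rule f_least)
    show "\<Union>(f ` A) \<subseteq> f (\<Union>A)"
      using assms by (intro UN_least f_mono) auto
  qed (use assms sub in blast)+
  show "f (\<Union>A) \<subseteq> f (\<Union>(f ` A))"
    using sub by (intro f_mono) blast+
qed

abbreviation R where "R \<equiv> nucleus_image (powerset_magma N) f"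

lemma R_simps [simp]:
  "carrier R = f ` Pow (carrier N)"
  "eq R = (=)"
  "le R = (\<subseteq>)"
  "omult R = (\<lambda>X Y. f (setmult N X Y))"
  by (simp_all add: nucleus_image_def)

lemma carrier_R_iff: "X \<in> f ` Pow (carrier N) \<longleftrightarrow> X \<subseteq> carrier N \<and> f X = X"
proof
  assume "X \<in> f ` Pow (carrier N)"
  then show "X \<subseteq> carrier N \<and> f X = X" by (auto simp: f_idem dest: f_closed)
next
  assume "X \<subseteq> carrier N \<and> f X = X"
  then show "X \<in> f ` Pow (carrier N)" by (metis PowI image_eqI)
qed

lemma carrier_R_subset: "f ` Pow (carrier N) \<subseteq> Pow (carrier N)"
  using f_closed by auto

lemma image_f_carrier_R: "A \<subseteq> f ` Pow (carrier N) \<Longrightarrow> f ` A = A"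
  using image_cong[of A A f "\<lambda>X. X"] carrier_R_iff by (auto simp: subset_iff)

sublocale R: ordered_magma R
proof -
  interpret partial_order R by (rule partial_order_subset_order) simp_all
  show "ordered_magma R"
  proof unfold_locales
    fix X Y assume "X \<in> carrier R" "Y \<in> carrier R"
    then show "X \<cdot>\<^bsub>R\<^esub> Y \<in> carrier R"
      using setmult_closed by (auto simp: carrier_R_iff f_closed f_idem)
  next
    fix X X' Y Y'
    assume "X \<in> carrier R" "X' \<in> carrier R" "Y \<in> carrier R" "Y' \<in> carrier R"
      "X \<sqsubseteq>\<^bsub>R\<^esub> X'" "Y \<sqsubseteq>\<^bsub>R\<^esub> Y'"
    then show "X \<cdot>\<^bsub>R\<^esub> Y \<sqsubseteq>\<^bsub>R\<^esub> X' \<cdot>\<^bsub>R\<^esub> Y'"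
      by (simp add: carrier_R_iff f_mono setmult_mono setmult_closed)
  qed
qed

text \<open>A fixed point containing all members of \<open>A\<close> contains their union and hence
  its closure. For empty \<open>A\<close> the supremum is \<open>f {}\<close>, the least
  element.\<close>

lemma is_lub_R_iff:
  assumes "A \<subseteq> f ` Pow (carrier N)"
  shows "is_lub R s A \<longleftrightarrow> s = f (\<Union>A)"
proof -
  have sub: "\<Union>A \<subseteq> carrier N" using assms carrier_R_subset by blast
  have "is_lub R (f (\<Union>A)) A"
  proof (subst is_lub_iff)
    show "A \<subseteq> carrier R" using assms by simp
    have "f (\<Union>A) \<subseteq> U" if "U \<in> f ` Pow (carrier N)" "\<forall>X\<in>A. X \<subseteq> U" for U
      using that f_mono[of U "\<Union>A"] by (auto simp: carrier_R_iff)
    then show "f (\<Union>A) \<in> carrier R \<and> (\<forall>X\<in>A. X \<sqsubseteq>\<^bsub>R\<^esub> f (\<Union>A)) \<and>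
        (\<forall>U\<in>carrier R. (\<forall>X\<in>A. X \<sqsubseteq>\<^bsub>R\<^esub> U) \<longrightarrow> f (\<Union>A) \<sqsubseteq>\<^bsub>R\<^esub> U)"
      using sub f_expansive[OF sub] by auto
  qed
  then show ?thesis using R.least_unique by blast
qed

lemma prequantale_R: "prequantale R"
proof (rule R.prequantaleI)
  fix A assume "A \<subseteq> carrier R"
  then show "\<exists>s. is_lub R s A" using is_lub_R_iff by auto
next
  fix X s A assume "X \<in> carrier R" and A: "A \<subseteq> carrier R" and s: "is_lub R s A"
  then have X: "X \<subseteq> carrier N" "f X = X" by (auto simp: carrier_R_iff)
  have s_eq: "s = f (\<Union>A)" using s A is_lub_R_iff by simp
  have A': "\<And>Y. Y \<in> A \<Longrightarrow> Y \<subseteq> carrier N" and UA: "\<Union>A \<subseteq> carrier N"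
    using A by (auto simp: carrier_R_iff subset_iff)
  \<comment> \<open>\<open>X\<close> is a fixed point, so \<open>f_setmult\<close> applies with
    \<open>f X\<close> in place of \<open>X\<close> and strips the closure off
    \<open>s\<close>.\<close>
  have "f (setmult N X s) = f (setmult N X (\<Union>A))"
    using f_setmult[OF X(1) UA] X s_eq by simp
  also have "\<dots> = f (\<Union>(setmult N X ` A))" by (simp add: setmult_Union_right)
  also have "\<dots> = f (\<Union>Y\<in>A. f (setmult N X Y))"
    using f_Union[of "setmult N X ` A"] setmult_closed[OF X(1) A'] by (auto simp: image_image)
  finally show "is_lub R (X \<cdot>\<^bsub>R\<^esub> s) ((\<lambda>Y. X \<cdot>\<^bsub>R\<^esub> Y) ` A)"
    using setmult_closed[OF X(1) A'] by (subst is_lub_R_iff) auto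
  have "f (setmult N s X) = f (setmult N (\<Union>A) X)"
    using f_setmult[OF UA X(1)] X s_eq by simp
  also have "\<dots> = f (\<Union>((\<lambda>Y. setmult N Y X) ` A))" by (simp add: setmult_Union_left)
  also have "\<dots> = f (\<Union>Y\<in>A. f (setmult N Y X))"
    using f_Union[of "(\<lambda>Y. setmult N Y X) ` A"] setmult_closed[OF A' X(1)]
    by (auto simp: image_image)
  finally show "is_lub R (s \<cdot>\<^bsub>R\<^esub> X) ((\<lambda>Y. Y \<cdot>\<^bsub>R\<^esub> X) ` A)"
    using setmult_closed[OF A' X(1)] by (subst is_lub_R_iff) auto
qed

end

section \<open>Compact elements in the image of a finitary nucleus\<close>

locale powerset_finitary_nucleus = powerset_nucleus +
  assumes finitary: "finitary (powerset_magma N) f"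
begin

text \<open>Suprema in the power set are unions, so being finitary amounts to preserving directed
  unions.\<close>

lemma f_directed_Union:
  assumes "directed_in (powerset_magma N) D"
  shows "f (\<Union>D) = \<Union>(f ` D)"
proof -
  have D: "D \<subseteq> Pow (carrier N)" using assms by (simp add: directed_in_def)
  then have fD: "f ` D \<subseteq> Pow (carrier N)" using f_closed by blast
  have "is_lub (powerset_magma N) (f (\<Union>D)) (f ` D)"
    using finitary assms is_lub_powerset_iff[OF D] unfolding finitary_def by blast
  then show ?thesis using is_lub_powerset_iff[OF fD] by blast
qed

lemma directed_finite_subsets:
  assumes "X \<subseteq> carrier N"
  shows "directed_in (powerset_magma N) {F. finite F \<and> F \<subseteq> X}"
proof -
  interpret partial_order "powerset_magma N" by (rule partial_order_subset_order) simp_all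
  have "\<exists>H\<in>{F. finite F \<and> F \<subseteq> X}. F \<subseteq> H \<and> G \<subseteq> H"
    if "F \<in> {F. finite F \<and> F \<subseteq> X}" "G \<in> {F. finite F \<and> F \<subseteq> X}" for F G
    using that by (intro bexI[of _ "F \<union> G"]) auto
  with assms show ?thesis unfolding directed_in_iff by auto
qed

text \<open>Every set is the directed union of its finite subsets.\<close>

lemma f_eq_Union_finite:
  assumes "X \<subseteq> carrier N"
  shows "f X = (\<Union>F\<in>{F. finite F \<and> F \<subseteq> X}. f F)"
proof -
  have "\<Union>{F. finite F \<and> F \<subseteq> X} = X" by (auto intro: exI[of _ "{_}"])
  then show ?thesis using f_directed_Union[OF directed_finite_subsets[OF assms]] by simp
qed

text \<open>Directedness depends only on the inclusions between members. The transfer is required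
  because finitariness is stated for directed families in the whole power set.\<close>

lemma directed_R_imp:
  assumes "directed_in R D"
  shows "directed_in (powerset_magma N) D"
proof -
  interpret P: partial_order "powerset_magma N" by (rule partial_order_subset_order) simp_all
  show ?thesis
    using assms order_trans[OF _ carrier_R_subset] unfolding R.directed_in_iff P.directed_in_iff
    by simp
qed

text \<open>A fixed point is the directed union of the closures of its finite subsets, so a compact
  one equals one of them. Conversely, directed suprema of fixed points are plain unions, and a
  finite set inside such a union lies in a single member.\<close>

lemma compact_elements_R: "compact_elements R = {f F |F. finite F \<and> F \<subseteq> carrier N}"
proof (intro equalityI subsetI)
  fix X assume comp: "X \<in> compact_elements R"
  then have X: "X \<subseteq> carrier N" "f X = X"
    using compact_elements_subset[of R] by (auto simp: carrier_R_iff subset_iff)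
  let ?D = "f ` {F. finite F \<and> F \<subseteq> X}"
  have D: "?D \<subseteq> f ` Pow (carrier N)" using X by auto
  have "\<exists>Z\<in>?D. f F \<subseteq> Z \<and> f G \<subseteq> Z" if "finite F" "F \<subseteq> X" "finite G" "G \<subseteq> X" for F G
  proof -
    have "F \<union> G \<subseteq> carrier N" using that X(1) by blast
    then have "f F \<subseteq> f (F \<union> G)" "f G \<subseteq> f (F \<union> G)" by (simp_all add: f_mono)
    with that show ?thesis by (intro bexI[of _ "f (F \<union> G)"]) auto
  qed
  then have "directed_in R ?D" unfolding R.directed_in_iff using D by auto
  moreover have "\<Union>?D = X" using f_eq_Union_finite[OF X(1)] X by simp
  then have "is_lub R X ?D" using is_lub_R_iff[OF D] X by simp
  ultimately obtain F where F: "finite F" "F \<subseteq> X" "X \<subseteq> f F"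
    using comp by (auto elim!: compact_elementsD)
  moreover have "f F \<subseteq> X" using f_mono[of X F] X F by simp
  ultimately show "X \<in> {f F |F. finite F \<and> F \<subseteq> carrier N}" using X by blast
next
  fix X assume "X \<in> {f F |F. finite F \<and> F \<subseteq> carrier N}"
  then obtain F where F: "finite F" "F \<subseteq> carrier N" and X: "X = f F" by blast
  have "\<exists>Y\<in>D. X \<subseteq> Y" if D: "directed_in R D" and s: "is_lub R s D" "X \<subseteq> s" for D s
  proof -
    have DR: "D \<subseteq> f ` Pow (carrier N)" using D by (simp add: directed_in_def)
    \<comment> \<open>\<open>f\<close> commutes with this directed union and fixes every member, so
      no closure remains in the supremum.\<close>
    have "s = \<Union>D"
      using s f_directed_Union[OF directed_R_imp[OF D]] is_lub_R_iff[OF DR] image_f_carrier_R[OF DR]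
      by simp
    then have "F \<subseteq> \<Union>D" using s X f_expansive F by blast
    \<comment> \<open>Finitely many members cover the finite set \<open>F\<close>, and directedness
      puts them all under one \<open>Y\<close> in \<open>D\<close>.\<close>
    then obtain E where E: "finite E" "E \<subseteq> D" "F \<subseteq> \<Union>E"
      using finite_subset_Union[OF F(1)] by blast
    then obtain Y where Y: "Y \<in> D" "Y \<in> Upper R E" using D unfolding directed_in_def by blast
    have "\<Union>E \<subseteq> Y"
    proof (rule Union_least)
      fix X assume "X \<in> E"
      then show "X \<subseteq> Y" using Y(2) E(2) DR by (simp add: Upper_def subsetD)
    qed
    then have "F \<subseteq> Y" using E by blast
    moreover have "Y \<subseteq> carrier N" "f Y = Y" using Y DR by (auto simp: carrier_R_iff subset_iff)
    ultimately show ?thesis using f_mono[of Y F] X Y by auto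
  qed
  then show "X \<in> compact_elements R" using F X by (auto simp: compact_elements_def)
qed

lemma precoherent_R: "precoherent R"
proof unfold_locales
  fix X assume "X \<in> carrier R"
  then have X: "X \<subseteq> carrier N" "f X = X" by (auto simp: carrier_R_iff)
  let ?D = "f ` {F. finite F \<and> F \<subseteq> X}"
  have "\<Union>?D = X" using f_eq_Union_finite[OF X(1)] X by simp
  moreover have D: "?D \<subseteq> f ` Pow (carrier N)" using X by auto
  ultimately have "is_lub R X ?D" using is_lub_R_iff[OF D] X by simp
  moreover have "?D \<subseteq> compact_elements R"
    using order_trans[OF _ X(1)] unfolding compact_elements_R by blast
  ultimately show "\<exists>A. A \<subseteq> compact_elements R \<and> is_lub R X A" by blast
next
  fix X Y assume "X \<in> compact_elements R" "Y \<in> compact_elements R"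
  then obtain F G where FG: "finite F" "F \<subseteq> carrier N" "X = f F" "finite G" "G \<subseteq> carrier N" "Y = f G"
    unfolding compact_elements_R by blast
  then have "X \<cdot>\<^bsub>R\<^esub> Y = f (setmult N F G)" by (simp add: f_setmult)
  then show "X \<cdot>\<^bsub>R\<^esub> Y \<in> compact_elements R"
    using FG finite_setmult[of F G N] setmult_closed[of F G] unfolding compact_elements_R by blast
qed

end

lemma isomorphic_nucleus_image_imp_precoherent_prequantale:
  assumes "ordered_magma M" "ordered_magma N"
    and "nucleus (powerset_magma N) f" "finitary (powerset_magma N) f"
    and "omagma_isomorphic M (nucleus_image (powerset_magma N) f)"
  shows "prequantale M \<and> precoherent M"
proof -
  interpret powerset_finitary_nucleus N f
    using assms
    by (simp add: powerset_finitary_nucleus_def powerset_nucleus_def powerset_nucleus_axioms_def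
        powerset_finitary_nucleus_axioms_def)
  show ?thesis
    using assms isomorphism_precoherent_prequantale prequantale_R precoherent_R
    unfolding omagma_isomorphic_def by blast
qed

subsection \<open>Ideals of a prequantic semilattice\<close>

context prequantic_semilattice
begin

text \<open>A common upper bound of \<open>x\<close> and \<open>y\<close> dominates
  \<open>x \<squnion> y\<close>, and \<open>\<bottom>\<close> lies below any member. In this
  algebraic form, unions and preimages are easily tested for being ideals.\<close>

lemma order_ideal_iff:
  "order_ideal Q I \<longleftrightarrow>
    I \<subseteq> carrier Q \<and> \<bottom> \<in> I \<and> (\<forall>x\<in>I. \<forall>y\<in>I. x \<squnion> y \<in> I) \<and>
    (\<forall>x\<in>I. \<forall>y\<in>carrier Q. y \<sqsubseteq> x \<longrightarrow> y \<in> I)"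
proof
  assume I: "order_ideal Q I"
  then have sub: "I \<subseteq> carrier Q" and ne: "I \<noteq> {}"
    and dir: "\<And>x y. x \<in> I \<Longrightarrow> y \<in> I \<Longrightarrow> \<exists>z\<in>I. x \<sqsubseteq> z \<and> y \<sqsubseteq> z"
    and down: "\<And>x y. x \<in> I \<Longrightarrow> y \<in> carrier Q \<Longrightarrow> y \<sqsubseteq> x \<Longrightarrow> y \<in> I"
    by (auto simp: order_ideal_def directed_in_iff)
  have "x \<squnion> y \<in> I" if xy: "x \<in> I" "y \<in> I" for x y
  proof -
    obtain z where "z \<in> I" "x \<sqsubseteq> z" "y \<sqsubseteq> z" using dir xy by blast
    moreover from this have "x \<squnion> y \<sqsubseteq> z" using xy sub by (intro join_le) auto
    ultimately show ?thesis using down xy sub by (meson join_closed subsetD)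
  qed
  moreover have "\<bottom> \<in> I" using ne sub down bottom_lower by (metis bottom_closed ex_in_conv subsetD)
  ultimately show "I \<subseteq> carrier Q \<and> \<bottom> \<in> I \<and> (\<forall>x\<in>I. \<forall>y\<in>I. x \<squnion> y \<in> I) \<and>
    (\<forall>x\<in>I. \<forall>y\<in>carrier Q. y \<sqsubseteq> x \<longrightarrow> y \<in> I)"
    using sub down by blast
next
  assume I: "I \<subseteq> carrier Q \<and> \<bottom> \<in> I \<and> (\<forall>x\<in>I. \<forall>y\<in>I. x \<squnion> y \<in> I) \<and>
    (\<forall>x\<in>I. \<forall>y\<in>carrier Q. y \<sqsubseteq> x \<longrightarrow> y \<in> I)"
  then have "\<exists>z\<in>I. x \<sqsubseteq> z \<and> y \<sqsubseteq> z" if "x \<in> I" "y \<in> I" for x y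
    using that by (meson join_left join_right subsetD)
  with I show "order_ideal Q I" by (auto simp: order_ideal_def directed_in_iff)
qed

text \<open>Two elements lying below the joins of finite sets \<open>S\<close> and \<open>T\<close>
  both lie below the join of \<open>S \<union> T\<close>, which belongs to the set itself.\<close>

lemma order_ideal_ideal_down:
  assumes Z: "Z \<subseteq> carrier Q" "Z \<noteq> {}"
  shows "order_ideal Q (ideal_down Q Z)"
proof -
  have sup_mono: "\<Squnion>S \<sqsubseteq> \<Squnion>T"
    if "finite T" "T \<subseteq> Z" "S \<noteq> {}" "S \<subseteq> T" for S T
  proof -
    have "is_lub Q (\<Squnion>S) S" "is_lub Q (\<Squnion>T) T"
      using that Z by (auto intro!: finite_sup_least intro: finite_subset)
    moreover have "S \<subseteq> carrier Q" "T \<subseteq> carrier Q" using that Z by auto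
    ultimately show ?thesis using that(4) by (simp add: is_lub_iff subset_iff)
  qed
  have "\<exists>z\<in>ideal_down Q Z. x \<sqsubseteq> z \<and> y \<sqsubseteq> z" if "x \<in> ideal_down Q Z" "y \<in> ideal_down Q Z" for x y
  proof -
    from that obtain S T where S: "x \<in> carrier Q" "finite S" "S \<noteq> {}" "S \<subseteq> Z" "x \<sqsubseteq> \<Squnion>S"
      and T: "y \<in> carrier Q" "finite T" "T \<noteq> {}" "T \<subseteq> Z" "y \<sqsubseteq> \<Squnion>T"
      by (auto simp: ideal_down_def)
    have c: "\<Squnion>S \<in> carrier Q" "\<Squnion>T \<in> carrier Q" "\<Squnion>(S \<union> T) \<in> carrier Q"
      using S T Z by (auto intro!: finite_sup_closed)
    have "\<Squnion>S \<sqsubseteq> \<Squnion>(S \<union> T)" "\<Squnion>T \<sqsubseteq> \<Squnion>(S \<union> T)" using S T by (auto intro!: sup_mono)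
    then have "x \<sqsubseteq> \<Squnion>(S \<union> T)" "y \<sqsubseteq> \<Squnion>(S \<union> T)" using S T c le_trans by blast+
    moreover have "\<Squnion>(S \<union> T) \<in> ideal_down Q Z"
      unfolding ideal_down_def using S T c by (auto intro!: exI[of _ "S \<union> T"])
    ultimately show ?thesis by blast
  qed
  moreover obtain z where "z \<in> Z" using Z by blast
  then have "\<Squnion>{z} \<in> ideal_down Q Z"
    unfolding ideal_down_def using Z by (auto intro!: exI[of _ "{z}"])
  moreover have "y \<in> ideal_down Q Z"
    if "x \<in> ideal_down Q Z" "y \<in> carrier Q" "y \<sqsubseteq> x" for x y
  proof -
    from that obtain T where T: "x \<in> carrier Q" "finite T" "T \<noteq> {}" "T \<subseteq> Z" "x \<sqsubseteq> \<Squnion>T"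
      by (auto simp: ideal_down_def)
    then have "\<Squnion>T \<in> carrier Q" using Z by auto
    then have "y \<sqsubseteq> \<Squnion>T" using that T le_trans by blast
    with that T show ?thesis by (auto simp: ideal_down_def)
  qed
  moreover have "ideal_down Q Z \<subseteq> carrier Q" by (auto simp: ideal_down_def)
  ultimately show ?thesis unfolding order_ideal_def directed_in_iff by auto
qed

lemma subset_ideal_down: "Z \<subseteq> carrier Q \<Longrightarrow> Z \<subseteq> ideal_down Q Z"
proof
  fix z assume "Z \<subseteq> carrier Q" "z \<in> Z"
  moreover from this have "\<Squnion>{z} = z" by (intro sup_equality sup_of_singletonI) auto
  ultimately show "z \<in> ideal_down Q Z"
    unfolding ideal_down_def by (auto intro!: exI[of _ "{z}"])
qed

text \<open>Being directed, \<open>I\<close> contains an upper bound \<open>u\<close> of every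
  finite \<open>T \<subseteq> Z\<close>. The join of \<open>T\<close> lies below \<open>u\<close>,
  and so does every element below that join.\<close>

lemma ideal_down_least:
  assumes I: "order_ideal Q I" and Z: "Z \<subseteq> I"
  shows "ideal_down Q Z \<subseteq> I"
proof
  fix y assume "y \<in> ideal_down Q Z"
  then obtain T where T: "y \<in> carrier Q" "finite T" "T \<noteq> {}" "T \<subseteq> Z" "y \<sqsubseteq> \<Squnion>T"
    by (auto simp: ideal_down_def)
  have IQ: "I \<subseteq> carrier Q" using I by (simp add: order_ideal_iff)
  have "\<exists>u\<in>I. u \<in> Upper Q T"
    using I T(2) order_trans[OF T(4) Z] by (simp add: order_ideal_def directed_in_def)
  then obtain u where u: "u \<in> I" "u \<in> Upper Q T" by blast
  have lub: "is_lub Q (\<Squnion>T) T" using T Z IQ by (intro finite_sup_least) auto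
  then have "\<Squnion>T \<sqsubseteq> u" using u by (simp add: least_def)
  moreover have "\<Squnion>T \<in> carrier Q" using lub by simp
  ultimately have "y \<sqsubseteq> u" using T u IQ le_trans by (meson subsetD)
  then show "y \<in> I" using I u T by (auto simp: order_ideal_def)
qed

text \<open>
  Adjoining \<open>\<bottom>\<close> makes the empty set generate the ideal \<open>{\<bottom>}\<close>; it does not change the
  ideal generated by a nonempty set.
\<close>

definition ideal_closure :: "'a set \<Rightarrow> 'a set"
  where "ideal_closure X = ideal_down Q (insert \<bottom> X)"

lemma order_ideal_ideal_closure: "X \<subseteq> carrier Q \<Longrightarrow> order_ideal Q (ideal_closure X)"
  unfolding ideal_closure_def by (intro order_ideal_ideal_down) auto

lemma subset_ideal_closure: "X \<subseteq> carrier Q \<Longrightarrow> X \<subseteq> ideal_closure X"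
  unfolding ideal_closure_def using subset_ideal_down[of "insert \<bottom> X"] by auto

lemma ideal_closure_least: "order_ideal Q I \<Longrightarrow> X \<subseteq> I \<Longrightarrow> ideal_closure X \<subseteq> I"
  unfolding ideal_closure_def by (intro ideal_down_least) (auto simp: order_ideal_iff)

lemma ideal_closure_closed: "X \<subseteq> carrier Q \<Longrightarrow> ideal_closure X \<subseteq> carrier Q"
  using order_ideal_ideal_closure by (simp add: order_ideal_iff)

lemma ideal_closure_ideal: "order_ideal Q I \<Longrightarrow> ideal_closure I = I"
  by (simp add: equalityI ideal_closure_least subset_ideal_closure order_ideal_iff)

lemma ideal_closure_mono:
  "Y \<subseteq> carrier Q \<Longrightarrow> X \<subseteq> Y \<Longrightarrow> ideal_closure X \<subseteq> ideal_closure Y"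
  by (meson ideal_closure_least order_ideal_ideal_closure order_trans subset_ideal_closure)

text \<open>For nonempty \<open>X\<close> each side is the least ideal containing
  \<open>X\<close>.\<close>

lemma ideal_down_eq_ideal_closure:
  assumes "X \<subseteq> carrier Q" "X \<noteq> {}"
  shows "ideal_down Q X = ideal_closure X"
  using assms
  by (intro equalityI ideal_down_least ideal_closure_least order_ideal_ideal_closure
      order_ideal_ideal_down subset_ideal_closure subset_ideal_down)

text \<open>The closure is taken in one factor at a time: the elements whose product with a fixed
  factor stays in \<open>?I\<close> form an ideal. This is where distributivity over joins and
  absorption by \<open>\<bottom>\<close> enter.\<close>

lemma ideal_closure_setmult:
  assumes X: "X \<subseteq> carrier Q" and Y: "Y \<subseteq> carrier Q"
  shows "setmult Q (ideal_closure X) (ideal_closure Y) \<subseteq> ideal_closure (setmult Q X Y)"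
proof -
  let ?I = "ideal_closure (setmult Q X Y)"
  have "order_ideal Q ?I"
    using X Y by (intro order_ideal_ideal_closure setmult_closed)
  then have I: "\<bottom> \<in> ?I" "\<And>x y. x \<in> ?I \<Longrightarrow> y \<in> ?I \<Longrightarrow> x \<squnion> y \<in> ?I"
    and down: "\<And>x y. x \<in> ?I \<Longrightarrow> y \<in> carrier Q \<Longrightarrow> y \<sqsubseteq> x \<Longrightarrow> y \<in> ?I"
    unfolding order_ideal_iff by blast+
  have prod: "x \<cdot> y \<in> ?I" if "x \<in> X" "y \<in> Y" for x y
    by (rule subsetD[OF subset_ideal_closure[OF setmult_closed[OF X Y]]])
      (use that in \<open>auto simp: setmult_iff\<close>)
  have left: "x \<cdot> y \<in> ?I" if "x \<in> ideal_closure X" "y \<in> Y" for x y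
  proof -
    have y: "y \<in> carrier Q" using that Y by blast
    \<comment> \<open>The preimage of \<open>?I\<close> under right multiplication by
      \<open>y\<close>: \<open>bottom_omult\<close> puts \<open>\<bottom>\<close> into it,
      \<open>omult_join_right\<close> closes it under joins, monotonicity closes it
      downward.\<close>
    have "order_ideal Q {x \<in> carrier Q. x \<cdot> y \<in> ?I}"
      unfolding order_ideal_iff using I y
      by (auto simp: bottom_omult omult_join_right intro: down omult_mono omult_closed)
    moreover have "X \<subseteq> {x \<in> carrier Q. x \<cdot> y \<in> ?I}" using X prod that by auto
    ultimately show ?thesis using that ideal_closure_least by blast
  qed
  have "x \<cdot> y \<in> ?I" if "x \<in> ideal_closure X" "y \<in> ideal_closure Y" for x y
  proof -
    have x: "x \<in> carrier Q" using that ideal_closure_closed[OF X] by blast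
    \<comment> \<open>The same argument in the second factor, starting from \<open>left\<close>
      instead of \<open>prod\<close>.\<close>
    have "order_ideal Q {y \<in> carrier Q. x \<cdot> y \<in> ?I}"
      unfolding order_ideal_iff using I x
      by (auto simp: omult_bottom omult_join_left intro: down omult_mono omult_closed)
    moreover have "Y \<subseteq> {y \<in> carrier Q. x \<cdot> y \<in> ?I}" using Y left that by auto
    ultimately show ?thesis using that ideal_closure_least by blast
  qed
  then show ?thesis by (auto simp: setmult_iff)
qed

section \<open>Ideals as the image of a finitary nucleus\<close>

lemma nucleus_ideal_closure: "nucleus (powerset_magma Q) ideal_closure"
proof -
  interpret P: partial_order "powerset_magma Q" by (rule partial_order_subset_order) simp_all
  have "isotone (powerset_magma Q) (powerset_magma Q) ideal_closure"
    by (intro isotoneI P.weak_partial_order_axioms) (simp add: ideal_closure_mono)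
  then show ?thesis
    by (simp add: nucleus_def closure_operation_def ideal_closure_closed subset_ideal_closure
        idempotent_def ideal_closure_ideal order_ideal_ideal_closure ideal_closure_setmult)
qed

text \<open>Members of the closures of \<open>X\<close> and \<open>Y\<close> both lie in the closure
  of a common \<open>Z\<close> in \<open>D\<close>, so the union of the closures is an ideal. Hence
  it contains the closure of \<open>\<Union>D\<close>.\<close>

lemma finitary_ideal_closure: "finitary (powerset_magma Q) ideal_closure"
  unfolding finitary_def
proof (intro allI impI, elim conjE)
  interpret P: partial_order "powerset_magma Q" by (rule partial_order_subset_order) simp_all
  fix D s assume dir: "directed_in (powerset_magma Q) D" and s: "is_lub (powerset_magma Q) s D"
  have D: "\<And>X. X \<in> D \<Longrightarrow> X \<subseteq> carrier Q" "D \<noteq> {}"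
    and dirD: "\<And>X Y. X \<in> D \<Longrightarrow> Y \<in> D \<Longrightarrow> \<exists>Z\<in>D. X \<subseteq> Z \<and> Y \<subseteq> Z"
    using dir by (auto simp: P.directed_in_iff)
  let ?U = "\<Union>(ideal_closure ` D)"
  note ideal = order_ideal_ideal_closure[OF D(1), unfolded order_ideal_iff]
  have "x \<squnion> y \<in> ?U" if xy: "x \<in> ideal_closure X" "X \<in> D" "y \<in> ideal_closure Y" "Y \<in> D" for x y X Y
  proof -
    obtain Z where Z: "Z \<in> D" "X \<subseteq> Z" "Y \<subseteq> Z" using dirD xy by blast
    then have "x \<in> ideal_closure Z" "y \<in> ideal_closure Z"
      using xy ideal_closure_mono[OF D(1)] by blast+
    then show ?thesis using ideal[OF Z(1)] Z(1) by blast
  qed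
  moreover have "\<bottom> \<in> ?U" using D(2) ideal by blast
  moreover have "?U \<subseteq> carrier Q" using ideal by blast
  moreover have "y \<in> ?U" if x: "x \<in> ?U" and y: "y \<in> carrier Q" "y \<sqsubseteq> x" for x y
  proof -
    obtain X where X: "X \<in> D" "x \<in> ideal_closure X" using x by blast
    then have "y \<in> ideal_closure X" using ideal[OF X(1)] y by simp
    with X show ?thesis by blast
  qed
  ultimately have "order_ideal Q ?U" unfolding order_ideal_iff by auto
  moreover have "\<Union>D \<subseteq> ?U"
    using subset_ideal_closure[OF D(1)] by auto
  ultimately have "ideal_closure (\<Union>D) \<subseteq> ?U" by (rule ideal_closure_least)
  moreover have "?U \<subseteq> ideal_closure (\<Union>D)"
    using D by (intro UN_least ideal_closure_mono) auto
  moreover have "ideal_closure ` D \<subseteq> Pow (carrier Q)" using ideal_closure_closed[OF D(1)] by auto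
  moreover have "s = \<Union>D"
    using s is_lub_powerset_iff[of D Q] dir by (simp add: directed_in_def)
  ultimately show "is_lub (powerset_magma Q) (ideal_closure s) (ideal_closure ` D)"
    by (simp add: is_lub_powerset_iff equalityI)
qed

text \<open>The fixed points of \<open>ideal_closure\<close> are precisely the ideals, so the
  identity map serves. The products agree because the product set of two ideals is nonempty, and
  there \<open>ideal_down\<close> and \<open>ideal_closure\<close> coincide.\<close>

lemma Idl_isomorphism_nucleus_image:
  "omagma_isomorphism (Idl Q) (nucleus_image (powerset_magma Q) ideal_closure) (\<lambda>I. I)"
proof -
  have "I \<in> ideal_closure ` Pow (carrier Q)" if I: "order_ideal Q I" for I
    using I ideal_closure_ideal[OF I] by (intro image_eqI[of _ _ I]) (simp_all add: order_ideal_iff)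
  then have carrier: "ideal_closure ` Pow (carrier Q) = {I. order_ideal Q I}"
    using order_ideal_ideal_closure by auto
  have "ideal_down Q (setmult Q I J) = ideal_closure (setmult Q I J)"
    if I: "order_ideal Q I" and J: "order_ideal Q J" for I J
  proof (rule ideal_down_eq_ideal_closure)
    show "setmult Q I J \<subseteq> carrier Q"
      using I J by (intro setmult_closed) (auto simp: order_ideal_iff)
    show "setmult Q I J \<noteq> {}"
      using I J by (auto simp: order_ideal_iff setmult_def)
  qed
  moreover have "weak_partial_order (Idl Q)"
    "weak_partial_order (nucleus_image (powerset_magma Q) ideal_closure)"
    by (intro partial_order.axioms(1) partial_order_subset_order;
        simp add: Idl_def nucleus_image_def)+
  ultimately show ?thesis
    by (simp add: omagma_isomorphism_def order_emb_def carrier Idl_def nucleus_image_def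
        bij_betw_def)
qed

end

lemma isomorphic_Idl_imp_isomorphic_nucleus_image:
  assumes "prequantic_semilattice N" "omagma_isomorphic M (Idl N)"
  shows "\<exists>f. nucleus (powerset_magma N) f \<and> finitary (powerset_magma N) f \<and>
    omagma_isomorphic M (nucleus_image (powerset_magma N) f)"
proof -
  interpret prequantic_semilattice N by fact
  obtain h where "omagma_isomorphism M (Idl N) h"
    using assms by (auto simp: omagma_isomorphic_def)
  from omagma_isomorphism_trans[OF this Idl_isomorphism_nucleus_image] show ?thesis
    using nucleus_ideal_closure finitary_ideal_closure omagma_isomorphic_def by blast
qed

subsection \<open>Compact elements of a precoherent prequantale\<close>

locale precoherent_prequantale = prequantale M + precoherent M for M (structure)
begin

abbreviation K where "K \<equiv> compact_elements M"
abbreviation MK where "MK \<equiv> M\<lparr>carrier := K\<rparr>"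

lemma compact_closed: "x \<in> K \<Longrightarrow> x \<in> carrier M"
  by (simp add: compact_elements_def)

lemma compacts_subset: "F \<subseteq> K \<Longrightarrow> F \<subseteq> carrier M"
  using compact_closed by auto

text \<open>If the supremum of a directed \<open>D\<close> dominates \<open>s\<close>, each
  \<open>x \<in> F\<close> lies below some \<open>d x \<in> D\<close>, and one member of
  \<open>D\<close> bounds these finitely many. With \<open>F\<close> empty this makes the least
  element compact.\<close>

lemma compact_sup:
  assumes F: "finite F" "F \<subseteq> K" and s: "is_lub M s F"
  shows "s \<in> K"
proof -
  have FM: "F \<subseteq> carrier M" using F compacts_subset by simp
  have "\<exists>y\<in>D. s \<sqsubseteq> y" if D: "directed_in M D" and t: "is_lub M t D" "s \<sqsubseteq> t" for D t
  proof -
    have DM: "D \<subseteq> carrier M" using D by (simp add: directed_in_def)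
    have "\<exists>y\<in>D. x \<sqsubseteq> y" if "x \<in> F" for x
    proof -
      have "x \<sqsubseteq> s" using s that FM by (simp add: is_lub_iff)
      then have "x \<sqsubseteq> t" using t s that FM le_trans by (meson least_closed subsetD)
      then show ?thesis using D t that F by (blast elim: compact_elementsD)
    qed
    then obtain d where d: "\<And>x. x \<in> F \<Longrightarrow> d x \<in> D \<and> x \<sqsubseteq> d x" by metis
    then obtain u where u: "u \<in> D" "u \<in> Upper M (d ` F)"
      using D F unfolding directed_in_def by (metis finite_imageI image_subsetI)
    have "x \<sqsubseteq> u" if "x \<in> F" for x
    proof -
      have "d x \<sqsubseteq> u" using u d that DM by (simp add: Upper_def subset_iff)
      then show ?thesis using d that FM DM u le_trans by (meson subsetD)
    qed
    then have "s \<sqsubseteq> u" using s u DM FM by (simp add: is_lub_iff subset_iff)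
    with u show ?thesis by blast
  qed
  with s show ?thesis by (auto simp: compact_elements_def)
qed

text \<open>Restricting to \<open>K\<close> leaves fewer upper bounds to compare with, so a supremum
  of \<open>M\<close> that lies in \<open>K\<close> remains one.\<close>

lemma is_lub_MK:
  assumes "F \<subseteq> K" "is_lub M s F" "s \<in> K"
  shows "is_lub MK s F"
proof -
  have "F \<subseteq> carrier M" using assms compacts_subset by simp
  then show ?thesis using assms by (auto simp: is_lub_iff compact_closed)
qed

sublocale MK: partial_order MK
proof -
  interpret weak_partial_order MK
    by (intro weak_partial_order_subset weak_partial_order_axioms compact_elements_subset)
  show "partial_order MK" by unfold_locales (simp add: eq_is_equal)
qed

lemma sup_compact:
  assumes "finite F" "F \<subseteq> K"
  shows "is_lub M (\<Squnion>F) F" "\<Squnion>F \<in> K" "is_lub MK (\<Squnion>F) F" "\<Squnion>\<^bsub>MK\<^esub>F = \<Squnion>F"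
proof -
  show lub: "is_lub M (\<Squnion>F) F" using assms by (simp add: is_lub_sup compacts_subset)
  show K: "\<Squnion>F \<in> K" using compact_sup[OF assms lub] .
  show lubK: "is_lub MK (\<Squnion>F) F" using is_lub_MK[OF assms(2) lub K] .
  show "\<Squnion>\<^bsub>MK\<^esub>F = \<Squnion>F" using MK.sup_equality[OF lubK] .
qed

text \<open>Distributivity over the empty family is absorption by the least element.\<close>

lemma omult_sup_empty: "a \<in> carrier M \<Longrightarrow> a \<cdot> \<Squnion>{} = \<Squnion>{}" "a \<in> carrier M \<Longrightarrow> \<Squnion>{} \<cdot> a = \<Squnion>{}"
  using omult_sup_left[of a "{}"] omult_sup_right[of a "{}"] by simp_all

lemma bottom_MK: "least MK (\<Squnion>{}) K"
  using sup_compact(3)[of "{}"] by simp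

lemma bottom_MK_eq: "\<bottom>\<^bsub>MK\<^esub> = \<Squnion>{}"
  using bottom_MK MK.least_unique unfolding bottom_def by (auto intro: some_equality)

text \<open>Joins and bottom of \<open>K\<close> are suprema in \<open>M\<close> of pairs and of the
  empty set, so the join and absorption laws are instances of the distributivity of
  \<open>M\<close>.\<close>

lemma prequantic_semilattice_MK: "prequantic_semilattice MK"
proof unfold_locales
  fix x y assume "x \<in> carrier MK" "y \<in> carrier MK"
  then have xy: "x \<in> K" "y \<in> K" by simp_all
  then show "x \<cdot>\<^bsub>MK\<^esub> y \<in> carrier MK" using compact_omult_closed by simp
  show "\<exists>s. is_lub MK s {x, y}" using xy sup_compact(3)[of "{x, y}"] by auto
  fix a assume "a \<in> carrier MK"
  then have a: "a \<in> K" by simp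
  have "{a \<cdot> x, a \<cdot> y} \<subseteq> K" "{x \<cdot> a, y \<cdot> a} \<subseteq> K" "{x, y} \<subseteq> K"
    using xy a compact_omult_closed by auto
  then show "a \<cdot>\<^bsub>MK\<^esub> (x \<squnion>\<^bsub>MK\<^esub> y) = (a \<cdot>\<^bsub>MK\<^esub> x) \<squnion>\<^bsub>MK\<^esub> (a \<cdot>\<^bsub>MK\<^esub> y)"
    "(x \<squnion>\<^bsub>MK\<^esub> y) \<cdot>\<^bsub>MK\<^esub> a = (x \<cdot>\<^bsub>MK\<^esub> a) \<squnion>\<^bsub>MK\<^esub> (y \<cdot>\<^bsub>MK\<^esub> a)"
    using omult_sup_left[of a "{x, y}"] omult_sup_right[of a "{x, y}"] xy a
    by (simp_all add: join_def sup_compact(4) compact_closed)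
next
  fix x x' y y'
  assume "x \<in> carrier MK" "x' \<in> carrier MK" "y \<in> carrier MK" "y' \<in> carrier MK"
    "x \<sqsubseteq>\<^bsub>MK\<^esub> x'" "y \<sqsubseteq>\<^bsub>MK\<^esub> y'"
  then show "x \<cdot>\<^bsub>MK\<^esub> y \<sqsubseteq>\<^bsub>MK\<^esub> x' \<cdot>\<^bsub>MK\<^esub> y'" by (simp add: omult_mono compact_closed)
next
  show "\<exists>x. least MK x (carrier MK)" using bottom_MK by auto
next
  fix x assume "x \<in> carrier MK"
  then have "x \<in> carrier M" using compact_closed by simp
  then show "\<bottom>\<^bsub>MK\<^esub> \<cdot>\<^bsub>MK\<^esub> x = \<bottom>\<^bsub>MK\<^esub>" "x \<cdot>\<^bsub>MK\<^esub> \<bottom>\<^bsub>MK\<^esub> = \<bottom>\<^bsub>MK\<^esub>"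
    by (simp_all add: bottom_MK_eq omult_sup_empty)
qed

sublocale MK: prequantic_semilattice MK
  by (rule prequantic_semilattice_MK)

lemma sub_prequantic_semilattice_K: "sub_prequantic_semilattice K M"
  unfolding sub_prequantic_semilattice_def
proof (intro conjI ballI allI impI)
  fix F assume "finite F \<and> F \<subseteq> K"
  then show "\<exists>s\<in>K. is_lub M s F" using sup_compact(1,2) by blast
qed (simp_all add: compact_elements_subset compact_omult_closed prequantic_semilattice_MK)

section \<open>The isomorphism onto the ideals of compact elements\<close>

definition below :: "'a \<Rightarrow> 'a set"
  where "below x = {k \<in> K. k \<sqsubseteq> x}"

text \<open>Precoherence supplies some set of compact elements with supremum \<open>x\<close>; it is
  contained in \<open>below x\<close>, which \<open>x\<close> bounds.\<close>

lemma is_lub_below: "x \<in> carrier M \<Longrightarrow> is_lub M x (below x)"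
proof -
  assume x: "x \<in> carrier M"
  then obtain X where X: "X \<subseteq> K" "is_lub M x X" using sup_of_compacts by blast
  then have "X \<subseteq> below x"
    using compacts_subset[OF X(1)] by (auto simp: below_def is_lub_iff)
  moreover have "below x \<subseteq> carrier M" using compact_closed by (auto simp: below_def)
  ultimately show ?thesis by (rule is_lub_between[OF X(2)]) (simp add: below_def)
qed

lemma below_subset_iff:
  assumes "x \<in> carrier M" "y \<in> carrier M"
  shows "below x \<subseteq> below y \<longleftrightarrow> x \<sqsubseteq> y"
proof
  have sub: "below x \<subseteq> carrier M" using compact_closed by (auto simp: below_def)
  assume "below x \<subseteq> below y"
  then have "\<forall>k\<in>below x. k \<sqsubseteq> y" by (auto simp: below_def)
  then show "x \<sqsubseteq> y" using is_lub_below[OF assms(1)] assms(2) by (simp add: is_lub_iff[OF sub])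
next
  assume "x \<sqsubseteq> y"
  then show "below x \<subseteq> below y"
    using assms le_trans[of _ x y] compact_closed by (auto simp: below_def)
qed

lemma order_ideal_below:
  assumes x: "x \<in> carrier M"
  shows "order_ideal MK (below x)"
  unfolding MK.order_ideal_iff
proof (intro conjI ballI impI)
  show "below x \<subseteq> carrier MK" by (auto simp: below_def)
  have "\<Squnion>{} \<sqsubseteq> x" using sup_compact(1)[of "{}"] x by (simp add: least_def)
  then show "\<bottom>\<^bsub>MK\<^esub> \<in> below x" using sup_compact(2)[of "{}"] by (simp add: bottom_MK_eq below_def)
next
  fix y z assume yz: "y \<in> below x" "z \<in> below x"
  then have "{y, z} \<subseteq> K" "{y, z} \<subseteq> carrier M" by (auto simp: below_def compact_closed)
  then have "\<Squnion>{y, z} \<sqsubseteq> x" using sup_compact(1)[of "{y, z}"] x yz by (simp add: is_lub_iff below_def)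
  then show "y \<squnion>\<^bsub>MK\<^esub> z \<in> below x"
    using sup_compact(2,4)[of "{y, z}"] \<open>{y, z} \<subseteq> K\<close> by (simp add: join_def below_def)
next
  fix y z assume "y \<in> below x" "z \<in> carrier MK" "z \<sqsubseteq>\<^bsub>MK\<^esub> y"
  then show "z \<in> below x" using x le_trans compact_closed by (auto simp: below_def)
qed

text \<open>\<open>I\<close> stays directed in \<open>M\<close>, so a compact element below its
  supremum lies below a member and therefore in \<open>I\<close>. This gives surjectivity of
  \<open>below\<close> and reduces multiplicativity to a computation of suprema.\<close>

lemma below_lub_ideal:
  assumes I: "order_ideal MK I" and s: "is_lub M s I"
  shows "below s = I"
proof
  have IK: "I \<subseteq> K" using I by (simp add: MK.order_ideal_iff)
  then have IM: "I \<subseteq> carrier M" by (rule compacts_subset)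
  have dir: "directed_in M I"
    using I IM unfolding order_ideal_def directed_in_iff MK.directed_in_iff by simp
  show "below s \<subseteq> I"
  proof
    fix k assume k: "k \<in> below s"
    then obtain i where "i \<in> I" "k \<sqsubseteq> i"
      using dir s by (auto simp: below_def elim: compact_elementsD)
    then show "k \<in> I" using I k by (auto simp: order_ideal_def below_def)
  qed
  show "I \<subseteq> below s" using s IK IM by (auto simp: below_def is_lub_iff)
qed

text \<open>An upper bound of all products is treated in two stages: with \<open>a \<in> X\<close>
  fixed, distributing \<open>a\<close> over \<open>Y\<close> bounds \<open>a \<cdot> y\<close>; then
  distributing \<open>y\<close> over \<open>X\<close> bounds \<open>x \<cdot> y\<close>.\<close>

lemma is_lub_setmult:
  assumes X: "X \<subseteq> carrier M" "is_lub M x X" and Y: "Y \<subseteq> carrier M" "is_lub M y Y"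
  shows "is_lub M (x \<cdot> y) (setmult M X Y)"
proof -
  have x: "x \<in> carrier M" and y: "y \<in> carrier M" using X Y by auto
  have sub: "setmult M X Y \<subseteq> carrier M" using X Y by (intro setmult_closed)
  have "x \<cdot> y \<sqsubseteq> u" if u: "u \<in> carrier M" "\<forall>z\<in>setmult M X Y. z \<sqsubseteq> u" for u
  proof -
    have "a \<cdot> y \<sqsubseteq> u" if a: "a \<in> X" for a
    proof -
      have aM: "a \<in> carrier M" using a X by blast
      have "(\<lambda>b. a \<cdot> b) ` Y \<subseteq> carrier M" using aM Y omult_closed by auto
      then show ?thesis
        using is_lub_omult_left[OF aM Y] u a by (simp add: is_lub_iff) (metis setmult_iff)
    qed
    moreover have "(\<lambda>a. a \<cdot> y) ` X \<subseteq> carrier M" using y X omult_closed by auto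
    ultimately show ?thesis using is_lub_omult_right[OF y X] u by (auto simp: is_lub_iff)
  qed
  moreover have "a \<cdot> b \<sqsubseteq> x \<cdot> y" if "a \<in> X" "b \<in> Y" for a b
    using that X Y x y by (intro omult_mono) (auto simp: is_lub_iff)
  ultimately show ?thesis
    unfolding is_lub_iff[OF sub] using x y omult_closed by (auto simp: setmult_iff)
qed

lemma below_omult:
  assumes x: "x \<in> carrier M" and y: "y \<in> carrier M"
  shows "below (x \<cdot> y) = ideal_down MK (setmult MK (below x) (below y))"
proof (rule below_lub_ideal)
  let ?Z = "setmult MK (below x) (below y)"
  let ?I = "ideal_down MK ?Z"
  have Z: "?Z = setmult M (below x) (below y)" by (simp add: setmult_def)
  note idx = order_ideal_below[OF x] and idy = order_ideal_below[OF y]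
  have ZK: "?Z \<subseteq> carrier MK"
    using MK.setmult_closed idx idy MK.order_ideal_iff by simp
  have ne: "?Z \<noteq> {}" using idx idy by (auto simp: MK.order_ideal_iff setmult_def)
  show I: "order_ideal MK ?I" using ZK ne by (rule MK.order_ideal_ideal_down)
  have ZM: "?Z \<subseteq> carrier M" using ZK compact_closed by auto
  have IM: "?I \<subseteq> carrier M" using I compact_closed by (auto simp: MK.order_ideal_iff)
  have lub: "is_lub M (x \<cdot> y) ?Z"
    unfolding Z by (intro is_lub_setmult is_lub_below x y) (auto simp: below_def compact_closed)
  then have "?Z \<subseteq> below (x \<cdot> y)" using ZK ZM by (auto simp: below_def is_lub_iff)
  then have "?I \<subseteq> below (x \<cdot> y)"
    by (intro MK.ideal_down_least order_ideal_below omult_closed x y)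
  moreover have "?Z \<subseteq> ?I" using ZK by (rule MK.subset_ideal_down)
  \<comment> \<open>\<open>?I\<close> is squeezed between the products, whose supremum is
    \<open>x \<cdot> y\<close>, and \<open>below (x \<cdot> y)\<close>, which is bounded by
    it.\<close>
  ultimately show "is_lub M (x \<cdot> y) ?I"
    using is_lub_between[OF lub _ IM] by (auto simp: below_def)
qed

text \<open>Injectivity is antisymmetry read through \<open>below_subset_iff\<close>; the preimage
  of an ideal is its supremum.\<close>

lemma isomorphism_below: "omagma_isomorphism M (Idl MK) below"
  unfolding omagma_isomorphism_def
proof (intro conjI ballI)
  have "inj_on below (carrier M)"
    by (rule inj_onI) (metis below_subset_iff le_antisym order_refl)
  moreover have "\<exists>x\<in>carrier M. I = below x" if I: "order_ideal MK I" for I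
  proof -
    have "I \<subseteq> carrier M" using I compact_closed by (auto simp: MK.order_ideal_iff)
    then obtain s where "is_lub M s I" using sup_exists by blast
    with I show ?thesis using below_lub_ideal by (metis least_closed)
  qed
  ultimately show "bij_betw below (carrier M) (carrier (Idl MK))"
    using order_ideal_below by (auto simp: bij_betw_def Idl_def)
  have "partial_order (Idl MK)" by (rule partial_order_subset_order) (simp_all add: Idl_def)
  then show "order_emb M (Idl MK) below"
    using below_subset_iff weak_partial_order_axioms
    by (simp add: order_emb_def Idl_def partial_order.axioms(1))
  fix x y assume "x \<in> carrier M" "y \<in> carrier M"
  then show "below (x \<cdot> y) = below x \<cdot>\<^bsub>Idl MK\<^esub> below y" by (simp add: below_omult Idl_def)
qed

end

section \<open>Assembling the equivalence of the four conditions\<close>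

lemma precoherent_prequantale_imp_isomorphic_Idl:
  assumes "prequantale M" "precoherent M"
  shows "sub_prequantic_semilattice (compact_elements M) M"
    and "omagma_isomorphic M (Idl (M\<lparr>carrier := compact_elements M\<rparr>))"
proof -
  interpret precoherent_prequantale M
    using assms by (simp add: precoherent_prequantale_def)
  show "sub_prequantic_semilattice (compact_elements M) M"
    by (rule sub_prequantic_semilattice_K)
  show "omagma_isomorphic M (Idl (M\<lparr>carrier := compact_elements M\<rparr>))"
    unfolding omagma_isomorphic_def using isomorphism_below by blast
qed

text \<open>Quantifiers do not range over types, so in the equivalences \<open>N\<close> lives on
  the carrier type \<open>'a\<close> of \<open>M\<close>, which suffices because the compact
  elements do. The last two conjuncts give the implications to (1) for \<open>N\<close> over a
  further type \<open>'b\<close>.\<close>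

theorem corollary6p19:
  fixes M :: "'a omagma"
  assumes "ordered_magma M"
  shows
    "((prequantale M \<and> precoherent M) \<longleftrightarrow>
        (\<exists>N :: 'a omagma. prequantic_semilattice N \<and> omagma_isomorphic M (Idl N)))
     \<and> ((prequantale M \<and> precoherent M) \<longleftrightarrow>
        (sub_prequantic_semilattice (compact_elements M) M \<and>
         omagma_isomorphic M (Idl (M\<lparr>carrier := compact_elements M\<rparr>))))
     \<and> ((prequantale M \<and> precoherent M) \<longleftrightarrow>
        (\<exists>(N :: 'a omagma) f. prequantic_semilattice N \<and>
           nucleus (powerset_magma N) f \<and> finitary (powerset_magma N) f \<and>
           omagma_isomorphic M (nucleus_image (powerset_magma N) f)))
     \<and> ((\<exists>N :: 'b omagma. prequantic_semilattice N \<and> omagma_isomorphic M (Idl N)) \<longrightarrow>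
        (prequantale M \<and> precoherent M))
     \<and> ((\<exists>(N :: 'b omagma) f. prequantic_semilattice N \<and>
           nucleus (powerset_magma N) f \<and> finitary (powerset_magma N) f \<and>
           omagma_isomorphic M (nucleus_image (powerset_magma N) f)) \<longrightarrow>
        (prequantale M \<and> precoherent M))"
proof -
  \<comment> \<open>The type variable \<open>'c\<close> is not fixed by the goal, so
    \<open>four_one\<close> and \<open>two_four\<close> become polymorphic and are used at both
    \<open>'a\<close> and \<open>'b\<close>.\<close>
  have four_one: "prequantale M \<and> precoherent M"
    if "\<exists>(N :: 'c omagma) f. prequantic_semilattice N \<and>
      nucleus (powerset_magma N) f \<and> finitary (powerset_magma N) f \<and>
      omagma_isomorphic M (nucleus_image (powerset_magma N) f)"
    using that assms isomorphic_nucleus_image_imp_precoherent_prequantale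
      prequantic_semilattice.axioms(1) by blast
  have two_four: "\<exists>(N :: 'c omagma) f. prequantic_semilattice N \<and>
      nucleus (powerset_magma N) f \<and> finitary (powerset_magma N) f \<and>
      omagma_isomorphic M (nucleus_image (powerset_magma N) f)"
    if "\<exists>N :: 'c omagma. prequantic_semilattice N \<and> omagma_isomorphic M (Idl N)"
    using that isomorphic_Idl_imp_isomorphic_nucleus_image by blast
  \<comment> \<open>The witness is \<open>M\<close> restricted to its compact elements, a prequantic
    semilattice by the last clause of \<open>sub_prequantic_semilattice\<close>.\<close>
  have three_two: "\<exists>N :: 'a omagma. prequantic_semilattice N \<and> omagma_isomorphic M (Idl N)"
    if "sub_prequantic_semilattice (compact_elements M) M \<and>
      omagma_isomorphic M (Idl (M\<lparr>carrier := compact_elements M\<rparr>))"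
    using that unfolding sub_prequantic_semilattice_def by blast
  have one_three: "sub_prequantic_semilattice (compact_elements M) M \<and>
      omagma_isomorphic M (Idl (M\<lparr>carrier := compact_elements M\<rparr>))"
    if "prequantale M \<and> precoherent M"
    using that precoherent_prequantale_imp_isomorphic_Idl[of M] by blast
  note one_two = three_two[OF one_three]
  show ?thesis
    by (intro conjI[of "_ \<longleftrightarrow> _"] conjI[of "_ \<longrightarrow> _"] iffI impI)
      (erule one_two four_one[OF two_four] one_three two_four[OF one_two]
        four_one four_one[OF two_four[OF three_two]])+
qed

end
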